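(* Let $f$ be a bistable nonlinearity (as specified in the context). There is a constant $C(f)>0$, depending only on $f$, such that the following holds for every $x_0>0$ and every $k\in C_c^\infty(\mathbb{R})$ with $\operatorname{supp}k\subset[-x_0,0]$. If $$C(f)>\exp\Big(-\int_{\mathbb{R}}k(s)\,ds\Big)\left(2+\max\left\{14,\Big(\int_{-x_0}^0\exp\Big(\int_{-x_0}^t k(s)\,ds\Big)dt\Big)^{1/2}\right\}\right)^2,$$ then the unique entire solution $u$ of $$\begin{cases}\partial_t u-\partial_{xx}u+k(x)\,\partial_x u=f(u)&\text{in }\mathbb{R}\times\mathbb{R},\\ u(t,x)-\phi(x+ct)\to0\ \text{ as }t\to-\infty&\text{uniformly in }x\in\mathbb{R}\end{cases}$$ is blocked to the left, i.e. there exists a stationary supersolution $w:\mathbb{R}\to\mathbb{R}$ of this problem such that $$u(t,x)\le w(x)\quad\text{for all }t\in\mathbb{R},\ x\in\mathbb{R},$$ and $w(x)\to0$ as $x\to-\infty$.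
   Context: Bistable nonlinearity: $f\in C^2([0,1])$, $f(0)=f(1)=0$, $f'(0)<0$, $f'(1)<0$, and for some $\theta\in(0,1)$ one has $f<0$ on $(0,\theta)$ and $f>0$ on $(\theta,1)$; moreover $\int_0^1 f(u)\,du>0$. For each such $f$ a fixed extension to a function $f\in C^2(\mathbb{R})$ is chosen with: $f(s)>0$ for $s<0$, $f(s)<0$ for $s>1$; $f'(s)\to d_+<0$ as $s\to+\infty$ and $f'(s)\to d_-<0$ as $s\to-\infty$; $\|f''\|_{L^\infty(\mathbb{R})}=\|f''\|_{L^\infty([0,1])}$. Traveling wave: $(\phi,c)$, $c>0$, is the unique (with $\phi$ unique up to translation; a translate is fixed) solution of $\phi''-c\phi'+f(\phi)=0$ on $\mathbb{R}$, $\phi(-\infty)=0$, $\phi(+\infty)=1$, $0<\phi<1$, $\phi'>0$. The unique solution $u$: it is known that there is exactly one entire (i.e. defined for all $t\in\mathbb{R}$) classical solution $u$ of the problem with $0<u<1$ and $\partial_t u>0$ in $\mathbb{R}\times\mathbb{R}$; $u$ denotes this solution. Stationary supersolution: a continuous function $w\in H^1_{\mathrm{loc}}(\mathbb{R})$ with $-w''+kw'\ge f(w)$ on $\mathbb{R}$ in the weak sense, i.e. $\int_{\mathbb{R}}\big(w'\zeta'+kw'\zeta-f(w)\zeta\big)dx\ge0$ for all nonnegative $\zeta\in C_c^\infty(\mathbb{R})$. *)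

theory Defs
  imports "HOL-Analysis.Analysis"
begin

definition Ck :: "nat \<Rightarrow> (real \<Rightarrow> real) \<Rightarrow> bool" where
  "Ck n g \<longleftrightarrow> (\<forall>i<n. \<forall>x. (deriv ^^ i) g differentiable (at x)) \<and> continuous_on UNIV ((deriv ^^ n) g)"

definition support :: "(real \<Rightarrow> real) \<Rightarrow> real set" where
  "support g = closure {x. g x \<noteq> 0}"

definition test_function :: "(real \<Rightarrow> real) \<Rightarrow> bool" where
  "test_function g \<longleftrightarrow> (\<forall>n. Ck n g) \<and> compact (support g)"

text \<open>Only the values of \<open>f\<close> on \<open>[0,1]\<close> matter here; derivatives at the end points are one-sided.\<close>

definition bistable :: "(real \<Rightarrow> real) \<Rightarrow> bool" where
  "bistable f \<longleftrightarrow>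
     (\<exists>f1 f2. (\<forall>s\<in>{0..1}. (f has_real_derivative f1 s) (at s within {0..1}) \<and>
                           (f1 has_real_derivative f2 s) (at s within {0..1})) \<and>
              continuous_on {0..1} f2 \<and> f1 0 < 0 \<and> f1 1 < 0) \<and>
     f 0 = 0 \<and> f 1 = 0 \<and>
     (\<exists>\<theta>\<in>{0<..<1}. (\<forall>s\<in>{0<..<\<theta>}. f s < 0) \<and> (\<forall>s\<in>{\<theta><..<1}. f s > 0)) \<and>
     (LBINT s:{0..1}. f s) > 0"

text \<open>Conditions on the fixed extension of a bistable nonlinearity to the whole line. Since the
  second derivative is continuous, its \<open>L\<^sup>\<infinity>\<close> norms are suprema; they are taken in \<^typ>\<open>ereal\<close>,
  where the supremum over the line is meaningful without a prior boundedness assumption.\<close>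

definition admissible_extension :: "(real \<Rightarrow> real) \<Rightarrow> bool" where
  "admissible_extension f \<longleftrightarrow>
     Ck 2 f \<and>
     (\<forall>s<0. f s > 0) \<and> (\<forall>s>1. f s < 0) \<and>
     (\<exists>d<0. (deriv f \<longlongrightarrow> d) at_top) \<and> (\<exists>d<0. (deriv f \<longlongrightarrow> d) at_bot) \<and>
     (SUP s. ereal \<bar>deriv (deriv f) s\<bar>) = (SUP s\<in>{0..1}. ereal \<bar>deriv (deriv f) s\<bar>)"

definition traveling_wave :: "(real \<Rightarrow> real) \<Rightarrow> (real \<Rightarrow> real) \<Rightarrow> real \<Rightarrow> bool" where
  "traveling_wave f \<phi> c \<longleftrightarrow>
     c > 0 \<and> Ck 2 \<phi> \<and>
     (\<forall>x. deriv (deriv \<phi>) x - c * deriv \<phi> x + f (\<phi> x) = 0) \<and>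
     (\<phi> \<longlongrightarrow> 0) at_bot \<and> (\<phi> \<longlongrightarrow> 1) at_top \<and>
     (\<forall>x. 0 < \<phi> x \<and> \<phi> x < 1) \<and> (\<forall>x. deriv \<phi> x > 0)"

text \<open>The arguments of \<open>u\<close> are time and space, in this order.\<close>

definition entire_solution ::
  "(real \<Rightarrow> real) \<Rightarrow> (real \<Rightarrow> real) \<Rightarrow> (real \<Rightarrow> real) \<Rightarrow> real \<Rightarrow> (real \<Rightarrow> real \<Rightarrow> real) \<Rightarrow> bool" where
  "entire_solution f k \<phi> c u \<longleftrightarrow>
     (\<exists>ut ux uxx.
        (\<forall>t x. ((\<lambda>s. u s x) has_real_derivative ut t x) (at t) \<and>
               ((\<lambda>y. u t y) has_real_derivative ux t x) (at x) \<and>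
               ((\<lambda>y. ux t y) has_real_derivative uxx t x) (at x)) \<and>
        continuous_on UNIV (\<lambda>(t, x). ut t x) \<and>
        continuous_on UNIV (\<lambda>(t, x). ux t x) \<and>
        continuous_on UNIV (\<lambda>(t, x). uxx t x) \<and>
        (\<forall>t x. ut t x - uxx t x + k x * ux t x = f (u t x)) \<and>
        (\<forall>t x. ut t x > 0)) \<and>
     (\<forall>t x. 0 < u t x \<and> u t x < 1) \<and>
     uniform_limit UNIV (\<lambda>t x. u t x - \<phi> (x + c * t)) (\<lambda>x. 0) at_bot"

definition L2_loc :: "(real \<Rightarrow> real) \<Rightarrow> bool" where
  "L2_loc g \<longleftrightarrow> g \<in> borel_measurable borel \<and> (\<forall>K. compact K \<longrightarrow> set_integrable lborel K (\<lambda>x. (g x)\<^sup>2))"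

definition weak_derivative :: "(real \<Rightarrow> real) \<Rightarrow> (real \<Rightarrow> real) \<Rightarrow> bool" where
  "weak_derivative w w' \<longleftrightarrow>
     (\<forall>\<zeta>. test_function \<zeta> \<longrightarrow> (LBINT x. w x * deriv \<zeta> x) = - (LBINT x. w' x * \<zeta> x))"

text \<open>The first three conditions in the scope of \<open>w'\<close> say that \<open>w \<in> H\<^sup>1\<^sub>l\<^sub>o\<^sub>c\<close> with weak derivative
  \<open>w'\<close>. As \<open>w'\<close> is unique up to a null set, the inequality does not depend on its choice.\<close>

definition stationary_supersolution :: "(real \<Rightarrow> real) \<Rightarrow> (real \<Rightarrow> real) \<Rightarrow> (real \<Rightarrow> real) \<Rightarrow> bool" where
  "stationary_supersolution f k w \<longleftrightarrow>
     continuous_on UNIV w \<and>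
     (\<exists>w'. L2_loc w \<and> L2_loc w' \<and> weak_derivative w w' \<and>
        (\<forall>\<zeta>. test_function \<zeta> \<and> (\<forall>x. \<zeta> x \<ge> 0) \<longrightarrow>
           (LBINT x. w' x * deriv \<zeta> x + k x * w' x * \<zeta> x - f (w x) * \<zeta> x) \<ge> 0))"

definition blocked_left ::
  "(real \<Rightarrow> real) \<Rightarrow> (real \<Rightarrow> real) \<Rightarrow> (real \<Rightarrow> real \<Rightarrow> real) \<Rightarrow> bool" where
  "blocked_left f k u \<longleftrightarrow>
     (\<exists>w. stationary_supersolution f k w \<and> (\<forall>t x. u t x \<le> w x) \<and> (w \<longlongrightarrow> 0) at_bot)"

end

theory Submission
  imports Defs
begin

text \<open>Where the drift lives, a supersolution with values in \<open>[0, \<theta>]\<close> may solve \<open>w'' = k w'\<close>, so its slope is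
  amplified by \<open>exp (\<integral>k)\<close> while its increment is the initial slope \<open>b\<close> times
  \<open>\<integral> exp (\<integral>k)\<close>. The hypothesis allows \<open>b\<close> to be small enough for \<open>w\<close> to stay below \<open>\<theta>\<close> and
  to match a decaying exponential on the left, and yet the slope at \<open>0\<close> to be large enough for a parabola
  of curvature at least \<open>max f\<close> to reach \<open>1\<close>.

  Since \<open>\<partial>\<^sub>t u > 0\<close>, each \<open>u(t, \<cdot>)\<close> is a strict stationary subsolution, hence cannot touch \<open>w\<close> from
  below. Thus the set of times with \<open>u(t, \<cdot>) \<le> w\<close> is closed and open; near \<open>x = -\<infinity>\<close> compactness is replaced
  by the monotonicity of \<open>f\<close> near \<open>0\<close>.\<close>

section \<open>Calculus at a local maximum\<close>

lemma has_real_derivative_imp_continuous_on: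
  fixes g :: "real \<Rightarrow> real"
  shows "(\<And>x. (g has_real_derivative g' x) (at x)) \<Longrightarrow> continuous_on A g"
  by (intro continuous_at_imp_continuous_on) (blast intro: DERIV_isCont)

text \<open>Since \<open>g' x = 0\<close>, a positive \<open>D\<close> would make \<open>g'\<close>
  positive just to the right of \<open>x\<close>, so \<open>g\<close> would exceed
  \<open>g x\<close> there. Only a right derivative of \<open>g'\<close> is assumed because the
  slope of the barrier has corners where its pieces meet.\<close>

lemma right_second_derivative_at_local_max:
  fixes g g' :: "real \<Rightarrow> real"
  assumes g: "\<And>y. (g has_real_derivative g' y) (at y)"
    and g': "(g' has_real_derivative D) (at x within {x..})"
    and "d > 0" and max: "\<And>y. \<bar>x - y\<bar> < d \<Longrightarrow> g y \<le> g x"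
  shows "D \<le> 0"
proof (rule ccontr)
  assume "\<not> D \<le> 0"
  then obtain e where e: "e > 0" "\<And>h. 0 < h \<Longrightarrow> h < e \<Longrightarrow> g' x < g' (x + h)"
    using has_real_derivative_pos_inc_right[OF g'] by auto
  have "g' x = 0"
    using DERIV_local_max[OF g \<open>d > 0\<close>] max by blast
  define y where "y = x + min d e / 2"
  have y: "x < y" "\<bar>x - y\<bar> < d" "y < x + e"
    using \<open>d > 0\<close> \<open>e > 0\<close> by (auto simp: y_def min_def field_simps)
  have "g x < g y"
  proof (rule DERIV_pos_imp_increasing_open[OF \<open>x < y\<close>])
    fix s assume "x < s" "s < y"
    then have "g' s > 0"
      using e(2)[of "s - x"] y \<open>g' x = 0\<close> by simp
    then show "\<exists>D. (g has_real_derivative D) (at s) \<and> D > 0"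
      using g by blast
  next
    show "continuous_on {x..y} g"
      using g by (rule has_real_derivative_imp_continuous_on)
  qed
  then show False
    using max[OF y(2)] by simp
qed

subsection \<open>Comparison with a monotone solution\<close>

text \<open>The number \<open>x0\<close> enters only through the absence of drift to the left of
  \<open>-x0\<close>, so the locale can be instantiated again with a larger value in its
  place.\<close>

locale monotone_solution =
  fixes f k :: "real \<Rightarrow> real" and u ut ux uxx :: "real \<Rightarrow> real \<Rightarrow> real" and x0 F :: real
  assumes du_t: "((\<lambda>s. u s x) has_real_derivative ut t x) (at t)"
    and du_x: "((\<lambda>y. u t y) has_real_derivative ux t x) (at x)"
    and dux_x: "((\<lambda>y. ux t y) has_real_derivative uxx t x) (at x)"
    and cont_ux: "continuous_on UNIV (\<lambda>(t, x). ux t x)"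
    and eq: "ut t x - uxx t x + k x * ux t x = f (u t x)"
    and ut_pos: "ut t x > 0"
    and u_pos: "0 < u t x" and u_less_1: "u t x < 1"
    and k_left: "x \<le> -x0 \<Longrightarrow> k x = 0"
    and f_le: "0 \<le> s \<Longrightarrow> s \<le> 1 \<Longrightarrow> f s \<le> F"
begin

lemma u_less: "s < t \<Longrightarrow> u s x < u t x"
  using DERIV_pos_imp_increasing[of s t "\<lambda>s. u s x"] du_t ut_pos by metis

lemma u_mono: "s \<le> t \<Longrightarrow> u s x \<le> u t x"
  using u_less[of s t x] by (cases "s = t") auto

lemma isCont_u_t: "isCont (\<lambda>s. u s x) t"
  using du_t DERIV_isCont by blast

lemma continuous_u_x: "continuous_on A (u t)"
  using du_x by (rule has_real_derivative_imp_continuous_on)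

text \<open>A time derivative together with a jointly continuous space derivative already gives
  total differentiability.\<close>

lemma continuous_u: "continuous_on UNIV (\<lambda>(t, x). u t x)"
proof -
  have "((\<lambda>(t, x). u t x) has_derivative (\<lambda>(s, y). s * ut t x + y * ux t x)) (at (t, x) within UNIV \<times> UNIV)" for t x
  proof (rule has_derivative_partialsI[where fy = "\<lambda>t x. blinfun_scaleR_left (ux t x)", THEN has_derivative_eq_rhs])
    show "((\<lambda>s. u s x) has_derivative (\<lambda>s. s * ut t x)) (at t within UNIV)"
      using du_t[of x t] by (simp add: has_field_derivative_def mult.commute[of _ "ut t x"])
    show "(u s has_derivative blinfun_apply (blinfun_scaleR_left (ux s y))) (at y within UNIV)" for s y
      using du_x[of s y] by (simp add: has_field_derivative_def mult.commute[of _ "ux s y"])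
    have "continuous (at (t, x)) (\<lambda>p. ux (fst p) (snd p))"
      using cont_ux by (simp add: continuous_on_eq_continuous_at split_def)
    then show "continuous (at (t, x) within UNIV \<times> UNIV) (\<lambda>(t, x). blinfun_scaleR_left (ux t x))"
      unfolding split_def UNIV_Times_UNIV
      by (rule bounded_linear.continuous[OF bounded_linear_blinfun_scaleR_left])
  qed auto
  then show ?thesis
    by (intro continuous_at_imp_continuous_on) (auto dest: has_derivative_continuous)
qed

text \<open>The barrier \<open>\<epsilon> + (x - y)\<^sup>2 + (3 + F) (t - r)\<close> exceeds \<open>1\<close> at distance \<open>1\<close> from \<open>y\<close>, so the
  maximum principle is only needed on a compact rectangle.\<close>

lemma upward_growth:
  assumes y: "y \<le> -x0 - 1" and le: "\<And>x. x \<le> -x0 \<Longrightarrow> u r x \<le> \<epsilon>" and "r \<le> t" and "F \<ge> 0" and "\<epsilon> \<ge> 0"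
  shows "u t y \<le> \<epsilon> + (3 + F) * (t - r)"
proof -
  \<comment> \<open>At an interior maximum in \<open>x\<close> the parabola gives
    \<open>uxx \<le> 2\<close>, and there is no drift in the rectangle, so
    \<open>ut \<le> 2 + F\<close>. The time slope \<open>3 + F\<close> is chosen to exceed
    this.\<close>
  define z where "z = (\<lambda>(s, x). u s x - \<epsilon> - (x - y)\<^sup>2 - (3 + F) * (s - r))"
  let ?Q = "{r..t} \<times> {y-1..y+1}"
  have "continuous_on ?Q z"
    unfolding z_def split_def
    by (intro continuous_intros continuous_on_subset[OF continuous_u[unfolded split_def]]) auto
  moreover have "compact ?Q" "?Q \<noteq> {}"
    using \<open>r \<le> t\<close> by (auto intro: compact_Times)
  ultimately obtain q where q: "q \<in> ?Q" "\<And>p. p \<in> ?Q \<Longrightarrow> z p \<le> z q"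
    using continuous_attains_sup by metis
  obtain s x where sx: "q = (s, x)" by force
  have "z (s, x) \<le> 0"
  proof (rule ccontr)
    assume "\<not> z (s, x) \<le> 0"
    then have pos: "z (s, x) > 0" by simp
    have range: "r \<le> s" "s \<le> t" "y - 1 \<le> x" "x \<le> y + 1"
      using q sx by auto
    have "s \<noteq> r"
    proof
      assume "s = r"
      then show False using pos le[of x] range y zero_le_power2[of "x - y"] by (simp add: z_def)
    qed
    then have "r < s" using range by simp
    have "(x - y)\<^sup>2 < 1"
    proof -
      have "0 \<le> (3 + F) * (s - r)"
        using \<open>F \<ge> 0\<close> range by simp
      moreover have "u s x - \<epsilon> - (x - y)\<^sup>2 - (3 + F) * (s - r) > 0"
        using pos by (simp add: z_def)
      ultimately show ?thesis
        using u_less_1[of s x] \<open>\<epsilon> \<ge> 0\<close> by linarith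
    qed
    then have "\<bar>x - y\<bar> < 1"
      by (simp add: abs_square_less_1)
    have "uxx s x - 2 \<le> 0"
    proof (rule right_second_derivative_at_local_max[where g = "\<lambda>x. z (s, x)" and g' = "\<lambda>x. ux s x - 2 * (x - y)"])
      show "((\<lambda>x. z (s, x)) has_real_derivative ux s x - 2 * (x - y)) (at x)" for x
        unfolding z_def by (auto intro!: derivative_eq_intros du_x)
      show "((\<lambda>x. ux s x - 2 * (x - y)) has_real_derivative uxx s x - 2) (at x within {x..})"
        by (auto intro!: derivative_eq_intros has_field_derivative_at_within[OF dux_x])
      show "0 < 1 - \<bar>x - y\<bar>" using \<open>\<bar>x - y\<bar> < 1\<close> by simp
      show "z (s, x') \<le> z (s, x)" if "\<bar>x - x'\<bar> < 1 - \<bar>x - y\<bar>" for x'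
        using q(2)[of "(s, x')"] that range sx by (auto simp: abs_if split: if_splits)
    qed
    \<comment> \<open>The maximum may lie on the final time \<open>t\<close>, so it is compared with
      earlier times only. These exist because \<open>r < s\<close>.\<close>
    moreover have "0 \<le> ut s x - (3 + F)"
    proof (rule ccontr)
      assume neg: "\<not> 0 \<le> ut s x - (3 + F)"
      have "((\<lambda>s. z (s, x)) has_real_derivative ut s x - (3 + F)) (at s)"
        unfolding z_def by (auto intro!: derivative_eq_intros du_t)
      from DERIV_neg_dec_left[OF this] neg obtain d
        where d: "d > 0" "\<And>h. 0 < h \<Longrightarrow> h < d \<Longrightarrow> z (s, x) < z (s - h, x)" by auto
      define h where "h = min d (s - r) / 2"
      have "0 < h" "h < d" "r \<le> s - h"
        using d \<open>r < s\<close> by (auto simp: h_def min_def field_simps)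
      with d(2)[of h] q(2)[of "(s - h, x)"] range sx show False
        by auto
    qed
    moreover have "ut s x \<le> uxx s x + F"
      using eq[of s x] k_left[of x] range y f_le[of "u s x"] u_pos[of s x] u_less_1[of s x] by simp
    ultimately show False by simp
  qed
  moreover have "z (t, y) \<le> z (s, x)"
    using q(2)[of "(t, y)"] sx \<open>r \<le> t\<close> by simp
  ultimately show ?thesis
    by (simp add: z_def)
qed

end

text \<open>The line splits into three regions: far left, where small values and the monotonicity of
  \<open>f\<close> give a maximum principle; a compact middle; and the right of \<open>l\<close>,
  where \<open>w = 1\<close> lies above \<open>u\<close>. The function \<open>v2\<close> is only a
  right derivative of \<open>v\<close>.\<close>

locale solution_and_supersolution = monotone_solution +
  fixes w v v2 :: "real \<Rightarrow> real" and \<delta> l :: real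
  assumes dw: "(w has_real_derivative v x) (at x)"
    and dv: "(v has_real_derivative v2 x) (at x within {x..})"
    and super: "v2 x \<le> k x * v x - f (w x)"
    and w_pos: "w x > 0" and w_right: "x \<ge> l \<Longrightarrow> w x = 1" and w_bot: "(w \<longlongrightarrow> 0) at_bot"
    and \<delta>_pos: "\<delta> > 0" and f_decreasing: "0 \<le> s \<Longrightarrow> s < s' \<Longrightarrow> s' \<le> \<delta> \<Longrightarrow> f s' < f s"
    and F_nonneg: "F \<ge> 0"
begin

lemma continuous_w: "continuous_on A w"
  using dw by (rule has_real_derivative_imp_continuous_on)

text \<open>At a contact point the slopes and the reaction terms agree and
  \<open>uxx \<le> v2\<close>, so subtracting the equation from the inequality for \<open>w\<close>
  leaves \<open>ut \<le> 0\<close>.\<close>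

lemma no_touching:
  assumes "\<And>x. u t x \<le> w x" shows "u t x < w x"
proof (rule ccontr)
  assume "\<not> u t x < w x"
  with assms[of x] have touch: "u t x = w x" by simp
  have d: "((\<lambda>x. u t x - w x) has_real_derivative ux t x - v x) (at x)" for x
    by (intro derivative_intros du_x dw)
  have max: "u t y - w y \<le> u t x - w x" for y
    using assms[of y] touch by simp
  have "uxx t x - v2 x \<le> 0"
    by (rule right_second_derivative_at_local_max[OF d _ zero_less_one max])
       (intro derivative_intros dv has_field_derivative_at_within[OF dux_x])
  moreover have "ux t x - v x = 0"
    using DERIV_local_max[OF d zero_less_one] max by blast
  ultimately show False
    using eq[of t x] ut_pos[of t x] super[of x] touch by simp
qed

text \<open>The tilt \<open>\<epsilon> (x - b)\<close> forces \<open>u - w\<close> to attain a maximum although nothing is known about \<open>u\<close> at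
  \<open>-\<infinity>\<close>.\<close>

lemma comparison_left:
  assumes b: "b \<le> -x0" and small: "\<And>x. x \<le> b \<Longrightarrow> u t x \<le> \<delta>" and "u t b \<le> w b" and "y \<le> b"
  shows "u t y \<le> w y"
proof (rule ccontr)
  assume "\<not> u t y \<le> w y"
  then have pos: "u t y - w y > 0" by simp
  then have "y < b" using assms by (cases "y = b") auto
  \<comment> \<open>With this size the tilt costs exactly half of the excess at \<open>y\<close>, so
    \<open>h y\<close> stays positive.\<close>
  define \<epsilon> where "\<epsilon> = (u t y - w y) / (2 * (b - y))"
  have "\<epsilon> > 0" using pos \<open>y < b\<close> by (simp add: \<epsilon>_def)
  define h where "h x = u t x - w x + \<epsilon> * (x - b)" for x
  have "h y = (u t y - w y) / 2"
    using \<open>y < b\<close> by (simp add: h_def \<epsilon>_def field_simps)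
  then have "h y > 0" using pos by simp
  \<comment> \<open>Left of \<open>b - 1 / \<epsilon>\<close> the tilt is at most -1, which
    outweighs \<open>u - w < 1\<close>. Hence \<open>h\<close> is nonpositive at both ends and its
    maximum is interior.\<close>
  define B where "B = min y (b - 1 / \<epsilon>)"
  have "continuous_on {B..b} h"
    unfolding h_def by (intro continuous_intros continuous_u_x continuous_w)
  moreover have "{B..b} \<noteq> {}" using \<open>y < b\<close> by (simp add: B_def min_le_iff_disj)
  ultimately obtain x where x: "x \<in> {B..b}" "\<And>x'. x' \<in> {B..b} \<Longrightarrow> h x' \<le> h x"
    using continuous_attains_sup[OF compact_Icc] by blast
  have "h x > 0"
    using x(2)[of y] \<open>h y > 0\<close> \<open>y < b\<close> by (simp add: B_def)
  have "h b \<le> 0"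
    using assms by (simp add: h_def)
  have "\<epsilon> * (B - b) \<le> \<epsilon> * (- (1 / \<epsilon>))"
    using \<open>\<epsilon> > 0\<close> by (intro mult_left_mono) (auto simp: B_def)
  then have "h B \<le> 0"
    using u_less_1[of t B] w_pos[of B] \<open>\<epsilon> > 0\<close> by (simp add: h_def)
  have "B < x" "x < b"
    using x(1) \<open>h x > 0\<close> \<open>h b \<le> 0\<close> \<open>h B \<le> 0\<close> by (auto simp: less_le)
  have "\<epsilon> * (x - b) < 0"
    using \<open>\<epsilon> > 0\<close> \<open>x < b\<close> by (simp add: mult_pos_neg)
  then have "w x < u t x"
    using \<open>h x > 0\<close> by (simp add: h_def)
  have "uxx t x - v2 x \<le> 0"
  proof (rule right_second_derivative_at_local_max[where g = h and g' = "\<lambda>x. ux t x - v x + \<epsilon>"])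
    show "(h has_real_derivative ux t x - v x + \<epsilon>) (at x)" for x
      unfolding h_def by (auto intro!: derivative_eq_intros du_x dw)
    show "((\<lambda>x. ux t x - v x + \<epsilon>) has_real_derivative uxx t x - v2 x) (at x within {x..})"
      by (auto intro!: derivative_eq_intros dv has_field_derivative_at_within[OF dux_x])
    show "0 < min (x - B) (b - x)" using \<open>B < x\<close> \<open>x < b\<close> by simp
    show "h x' \<le> h x" if "\<bar>x - x'\<bar> < min (x - B) (b - x)" for x'
      using that by (intro x(2)) auto
  qed
  moreover have "f (u t x) < f (w x)"
    using \<open>w x < u t x\<close> w_pos[of x] small[of x] \<open>x < b\<close> by (intro f_decreasing) auto
  \<comment> \<open>Without drift the slope of the tilt does not enter, and
    \<open>uxx \<le> v2 \<le> - f (w x) < - f (u t x) = uxx - ut\<close> contradicts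
    \<open>ut > 0\<close>.\<close>
  moreover have "k x = 0" using \<open>x < b\<close> b k_left by simp
  ultimately show False
    using eq[of t x] ut_pos[of t x] super[of x] by simp
qed

text \<open>A Dini argument: the open sets \<open>U n\<close> grow with \<open>n\<close> because
  \<open>u\<close> increases in time, and they cover the interval because \<open>u\<close> is
  continuous in time. By compactness a single one covers it.\<close>

lemma compact_gap:
  assumes "\<And>x. x \<in> {a..b} \<Longrightarrow> u t x < w x"
  shows "\<exists>\<eta>>0. \<forall>x\<in>{a..b}. u (t + \<eta>) x < w x"
proof -
  define U where "U n = {x. u (t + 1 / real (Suc n)) x < w x}" for n
  have "open (U n)" for n
    unfolding U_def by (intro open_Collect_less continuous_u_x continuous_w)
  moreover have "{a..b} \<subseteq> (\<Union>n. U n)"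
  proof
    fix x assume "x \<in> {a..b}"
    have "(\<lambda>n. t + 1 / real (Suc n)) \<longlonglongrightarrow> t + 0"
      by (intro tendsto_intros LIMSEQ_Suc[OF lim_1_over_n])
    then have "(\<lambda>n. u (t + 1 / real (Suc n)) x) \<longlonglongrightarrow> u t x"
      using isCont_tendsto_compose[OF isCont_u_t] by fastforce
    then have "eventually (\<lambda>n. u (t + 1 / real (Suc n)) x < w x) sequentially"
      using assms[OF \<open>x \<in> {a..b}\<close>] by (rule order_tendstoD)
    then show "x \<in> (\<Union>n. U n)"
      by (auto simp: U_def eventually_sequentially)
  qed
  ultimately obtain N where N: "finite N" "{a..b} \<subseteq> (\<Union>n\<in>N. U n)"
    by (rule compactE_image[OF compact_Icc])
  define m where "m = Max (insert 0 N)"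
  have "U n \<subseteq> U m" if "n \<in> N" for n
  proof
    fix x assume "x \<in> U n"
    have "n \<le> m" using N(1) that by (simp add: m_def)
    then have "u (t + 1 / real (Suc m)) x \<le> u (t + 1 / real (Suc n)) x"
      by (intro u_mono) (simp add: frac_le)
    then show "x \<in> U m" using \<open>x \<in> U n\<close> by (simp add: U_def)
  qed
  then have "{a..b} \<subseteq> U m" using N(2) by blast
  then show ?thesis
    by (intro exI[of _ "1 / real (Suc m)"]) (auto simp: U_def)
qed

lemma small_left: "\<epsilon> > 0 \<Longrightarrow> \<exists>b\<le>-x0. \<forall>x\<le>b. w x \<le> \<epsilon>"
proof -
  assume "\<epsilon> > 0"
  then have "eventually (\<lambda>x. w x < \<epsilon>) at_bot"
    using w_bot by (intro order_tendstoD)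
  then obtain B where "\<And>x. x \<le> B \<Longrightarrow> w x < \<epsilon>"
    by (auto simp: eventually_at_bot_linorder)
  then show ?thesis
    by (intro exI[of _ "min B (-x0)"]) (auto intro: less_imp_le)
qed

text \<open>The openness half of the continuation argument. The strict gap survives for a short time
  on a compact interval. To its left, \<open>upward_growth\<close> keeps \<open>u\<close> below
  \<open>\<delta>\<close> for a short time, which is what \<open>comparison_left\<close>
  requires.\<close>

lemma comparison_step:
  assumes le: "\<And>x. u t x \<le> w x"
  shows "\<exists>\<eta>>0. \<forall>x. u (t + \<eta>) x \<le> w x"
proof -
  obtain b where b: "b \<le> -x0" "\<And>x. x \<le> b \<Longrightarrow> w x \<le> \<delta> / 2"
    using small_left[of "\<delta> / 2"] \<delta>_pos by auto
  \<comment> \<open>Putting \<open>-b\<close> in the role of \<open>x0\<close> lets the growth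
    estimate start from \<open>u \<le> \<delta> / 2\<close> on \<open>x \<le> b\<close> alone. It
    then applies one unit further left, on \<open>x \<le> b - 1\<close>.\<close>
  interpret left: monotone_solution f k u ut ux uxx "-b" F
    using b by unfold_locales (auto intro: du_t du_x dux_x cont_ux eq ut_pos u_pos u_less_1 k_left f_le)
  obtain \<eta>1 where \<eta>1: "\<eta>1 > 0" "\<And>x. x \<in> {b-1..l} \<Longrightarrow> u (t + \<eta>1) x < w x"
    using compact_gap[of "b - 1" l t] no_touching[OF le] by blast
  \<comment> \<open>The second entry limits the growth \<open>(3 + F) * \<eta>\<close> to the
    remaining \<open>\<delta> / 2\<close>.\<close>
  define \<eta> where "\<eta> = min \<eta>1 (\<delta> / 2 / (3 + F))"
  have "\<eta> > 0" using \<eta>1 \<delta>_pos F_nonneg by (simp add: \<eta>_def)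
  have "\<eta> \<le> \<delta> / 2 / (3 + F)" by (simp add: \<eta>_def)
  then have \<eta>2: "(3 + F) * \<eta> \<le> \<delta> / 2"
    using F_nonneg by (subst (asm) pos_le_divide_eq) (auto simp: mult.commute)
  have mid: "u (t + \<eta>) x \<le> w x" if "x \<in> {b-1..l}" for x
    using \<eta>1(2)[OF that] u_mono[of "t + \<eta>" "t + \<eta>1" x] by (simp add: \<eta>_def)
  have small: "u (t + \<eta>) x \<le> \<delta>" if "x \<le> b - 1" for x
  proof -
    have "u (t + \<eta>) x \<le> \<delta> / 2 + (3 + F) * (t + \<eta> - t)"
      using that \<delta>_pos F_nonneg \<open>\<eta> > 0\<close> order_trans[OF le b(2)]
      by (intro left.upward_growth) auto
    then show ?thesis using \<eta>2 by simp
  qed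
  have "u (t + \<eta>) x \<le> w x" for x
  proof -
    consider "x \<le> b - 1" | "x \<in> {b-1..l}" | "x \<ge> l" by fastforce
    then show ?thesis
    proof cases
      case 1
      show ?thesis
      proof (cases "b - 1 \<le> l")
        case True
        then show ?thesis using comparison_left[of "b - 1" "t + \<eta>" x] small mid b(1) 1 by auto
      \<comment> \<open>Here the middle interval is empty, and the boundary point
        \<open>b - 1\<close> already lies where \<open>w = 1\<close>.\<close>
      next
        case False
        then have "u (t + \<eta>) (b - 1) \<le> w (b - 1)"
          using w_right[of "b - 1"] u_less_1[of "t + \<eta>" "b - 1"] by simp
        then show ?thesis using comparison_left[of "b - 1" "t + \<eta>" x] small b(1) 1 by auto
      qed
    qed (use mid w_right u_less_1[of "t + \<eta>" x] in auto)
  qed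
  then show ?thesis using \<open>\<eta> > 0\<close> by blast
qed

text \<open>Very early the wave is still far to the right, so \<open>u\<close> is uniformly small on
  every left half-line. It is then below the positive minimum of \<open>w\<close> on a compact
  interval and below \<open>\<delta>\<close> further left, where \<open>comparison_left\<close>
  finishes.\<close>

lemma comparison_initial:
  assumes "c > 0" "(\<phi> \<longlongrightarrow> 0) at_bot"
    and lim: "uniform_limit UNIV (\<lambda>t x. u t x - \<phi> (x + c * t)) (\<lambda>x. 0) at_bot"
  shows "\<exists>t. \<forall>x. u t x \<le> w x"
proof -
  obtain b where b: "b \<le> -x0" "\<And>x. x \<le> b \<Longrightarrow> w x \<le> \<delta>"
    using small_left[OF \<delta>_pos] by auto
  have "{b..max b l} \<noteq> {}" by simp
  then obtain z where "\<forall>x\<in>{b..max b l}. w z \<le> w x"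
    using continuous_attains_inf[OF compact_Icc _ continuous_w] by blast
  then obtain m where m: "m > 0" "\<And>x. x \<in> {b..max b l} \<Longrightarrow> m \<le> w x"
    using w_pos[of z] by blast
  define \<epsilon> where "\<epsilon> = min m \<delta>"
  have "\<epsilon> > 0" using m \<delta>_pos by (simp add: \<epsilon>_def)
  have "eventually (\<lambda>y. \<phi> y < \<epsilon> / 2) at_bot"
    using assms(2) \<open>\<epsilon> > 0\<close> by (intro order_tendstoD) auto
  then obtain B where B: "\<And>y. y \<le> B \<Longrightarrow> \<phi> y < \<epsilon> / 2"
    by (auto simp: eventually_at_bot_linorder)
  have "eventually (\<lambda>t. \<forall>x\<in>UNIV. dist (u t x - \<phi> (x + c * t)) 0 < \<epsilon> / 2) at_bot"
    using \<open>\<epsilon> > 0\<close> by (intro uniform_limitD[OF lim]) simp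
  then obtain T where T: "\<And>t x. t \<le> T \<Longrightarrow> \<bar>u t x - \<phi> (x + c * t)\<bar> < \<epsilon> / 2"
    by (auto simp: eventually_at_bot_linorder)
  \<comment> \<open>The second entry gives \<open>x + c * t \<le> B\<close> for all
    \<open>x \<le> max b l\<close>.\<close>
  define t where "t = min T ((B - max b l) / c)"
  have small: "u t x \<le> \<epsilon>" if "x \<le> max b l" for x
  proof -
    have "c * t \<le> c * ((B - max b l) / c)"
      using \<open>c > 0\<close> by (intro mult_left_mono) (auto simp: t_def)
    then have "x + c * t \<le> B" using that \<open>c > 0\<close> by simp
    moreover have "t \<le> T" by (simp add: t_def)
    ultimately have "\<phi> (x + c * t) < \<epsilon> / 2" "\<bar>u t x - \<phi> (x + c * t)\<bar> < \<epsilon> / 2"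
      using B T by auto
    then show ?thesis by linarith
  qed
  have right: "u t x \<le> w x" if "x \<ge> b" for x
  proof (cases "x \<le> max b l")
    case True
    then show ?thesis using small[of x] m(2)[of x] that by (simp add: \<epsilon>_def)
  next
    case False
    then show ?thesis using w_right[of x] u_less_1[of t x] by simp
  qed
  have "u t x \<le> w x" for x
  proof (cases "x \<ge> b")
    case False
    have "u t y \<le> \<delta>" if "y \<le> b" for y
      using small[of y] that by (simp add: \<epsilon>_def)
    then show ?thesis
      using comparison_left[of b t x] b right False by simp
  qed (rule right)
  then show ?thesis by blast
qed

text \<open>The good times form a set closed under going back in time. A finite supremum would be a
  good time by continuity, and \<open>comparison_step\<close> would then lead beyond it.\<close>

lemma comparison:
  assumes "\<exists>t. \<forall>x. u t x \<le> w x"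
  shows "u t x \<le> w x"
proof -
  define S where "S = {t. \<forall>x. u t x \<le> w x}"
  have "S \<noteq> {}" using assms by (auto simp: S_def)
  have down: "s \<in> S" if "t \<in> S" "s \<le> t" for s t
    using that u_mono[of s t] unfolding S_def mem_Collect_eq by (meson order_trans)
  have "\<not> bdd_above S"
  proof
    assume bdd: "bdd_above S"
    have "u (Sup S) x \<le> w x" for x
    proof (rule tendsto_upperbound)
      show "((\<lambda>s. u s x) \<longlongrightarrow> u (Sup S) x) (at_left (Sup S))"
        using isCont_u_t[of "Sup S" x] unfolding isCont_def by (rule tendsto_within_subset) simp
      have "s \<in> S" if "s < Sup S" for s
        using that down less_cSup_iff[OF \<open>S \<noteq> {}\<close> bdd] by (meson less_imp_le)
      then show "eventually (\<lambda>s. u s x \<le> w x) (at_left (Sup S))"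
        by (auto simp: eventually_at_filter S_def)
    qed auto
    then obtain \<eta> where "\<eta> > 0" "Sup S + \<eta> \<in> S"
      using comparison_step[of "Sup S"] unfolding S_def mem_Collect_eq by blast
    then show False using cSup_upper[OF \<open>Sup S + \<eta> \<in> S\<close> bdd] by simp
  qed
  then obtain s where "s \<in> S" "t \<le> s"
    by (meson bdd_above.I linear)
  then have "t \<in> S" by (rule down)
  then show ?thesis by (simp add: S_def)
qed

end

subsection \<open>Weak supersolutions\<close>

lemma test_function_differentiable:
  assumes "test_function \<zeta>"
  shows "(\<zeta> has_real_derivative deriv \<zeta> x) (at x)" "continuous_on A \<zeta>" "continuous_on A (deriv \<zeta>)"
proof -
  have "Ck 1 \<zeta>" using assms by (simp add: test_function_def)
  then have diff: "\<And>x. \<zeta> differentiable (at x)" and "continuous_on UNIV (deriv \<zeta>)"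
    by (auto simp: Ck_def)
  then show "continuous_on A (deriv \<zeta>)"
    using continuous_on_subset by blast
  show "(\<zeta> has_real_derivative deriv \<zeta> x) (at x)" for x
    using diff by (simp add: DERIV_deriv_iff_real_differentiable)
  then show "continuous_on A \<zeta>"
    by (rule has_real_derivative_imp_continuous_on)
qed

lemma not_in_supportD: "x \<notin> support \<zeta> \<Longrightarrow> \<zeta> x = 0"
  unfolding support_def using closure_subset[of "{x. \<zeta> x \<noteq> 0}"] by auto

lemma deriv_not_in_support: 
  assumes "x \<notin> support \<zeta>" shows "deriv \<zeta> x = 0"
proof -
  have "open (- support \<zeta>)" by (simp add: support_def open_Compl)
  then have "(\<zeta> has_real_derivative 0) (at x)"
    using assms not_in_supportD[of _ \<zeta>]
    by (intro has_field_derivative_transform_within_open[OF DERIV_const]) auto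
  then show ?thesis by (rule DERIV_imp_deriv)
qed

lemma test_function_bounded_support:
  assumes "test_function \<zeta>"
  obtains N where "N > 0" "\<And>x. N \<le> \<bar>x\<bar> \<Longrightarrow> \<zeta> x = 0" "\<And>x. N \<le> \<bar>x\<bar> \<Longrightarrow> deriv \<zeta> x = 0"
proof -
  have "bounded (support \<zeta>)"
    using assms by (simp add: test_function_def compact_imp_bounded)
  then obtain B where B: "\<And>x. x \<in> support \<zeta> \<Longrightarrow> \<bar>x\<bar> \<le> B"
    by (auto simp: bounded_iff)
  have out: "x \<notin> support \<zeta>" if "\<bar>B\<bar> + 1 \<le> \<bar>x\<bar>" for x
    using B[of x] that by auto
  show thesis
    using not_in_supportD[OF out] deriv_not_in_support[OF out] by (intro that[of "\<bar>B\<bar> + 1"]) auto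
qed

lemma LBINT_eq_set_LBINT:
  fixes h :: "real \<Rightarrow> real"
  assumes "\<And>x. x \<notin> A \<Longrightarrow> h x = 0"
  shows "(LBINT x. h x) = (LBINT x:A. h x)"
  unfolding set_lebesgue_integral_def using assms
  by (intro Bochner_Integration.integral_cong) (auto simp: indicator_def)

text \<open>This turns the Lebesgue integrals of the weak formulation into gauge integrals on a
  bounded interval, where the fundamental theorem of calculus applies.\<close>

lemma LBINT_has_integral:
  fixes h :: "real \<Rightarrow> real"
  assumes "continuous_on UNIV h" "\<And>x. N \<le> \<bar>x\<bar> \<Longrightarrow> h x = 0"
  shows "(h has_integral (LBINT x. h x)) {-N..N}"
proof -
  have int: "set_integrable lborel {-N..N} h"
    using assms(1) by (intro borel_integrable_atLeastAtMost') (auto intro: continuous_on_subset)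
  have "(LBINT x. h x) = (LBINT x:{-N..N}. h x)"
    using assms(2) by (intro LBINT_eq_set_LBINT) auto
  then show ?thesis
    using set_borel_integral_eq_integral[OF int] by (simp add: integrable_integral)
qed

lemma continuous_imp_L2_loc:
  assumes "continuous_on UNIV g" shows "L2_loc g"
  unfolding L2_loc_def set_integrable_def
proof (intro conjI allI impI)
  show "g \<in> borel_measurable borel"
    using assms by (rule borel_measurable_continuous_onI)
  fix K :: "real set" assume "compact K"
  moreover have "continuous_on K (\<lambda>x. (g x)\<^sup>2)"
    by (intro continuous_intros continuous_on_subset[OF assms]) auto
  ultimately show "integrable lborel (\<lambda>x. indicat_real K x *\<^sub>R (g x)\<^sup>2)"
    by (rule borel_integrable_compact)
qed

text \<open>Integration by parts against \<open>\<zeta>\<close>: since \<open>v\<close> is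
  continuous, the corners in \<open>S\<close> produce no jump terms, and the pointwise inequality
  can be integrated.\<close>

lemma stationary_supersolutionI:
  assumes dw: "\<And>x. (w has_real_derivative v x) (at x)" and cont_v: "continuous_on UNIV v"
    and "finite S" and dv: "\<And>x. x \<notin> S \<Longrightarrow> (v has_real_derivative v2 x) (at x)"
    and super: "\<And>x. v2 x \<le> k x * v x - f (w x)"
    and cont_k: "continuous_on UNIV k" and cont_fw: "continuous_on UNIV (\<lambda>x. f (w x))"
  shows "stationary_supersolution f k w"
proof -
  have cont_w: "continuous_on UNIV w"
    using dw by (rule has_real_derivative_imp_continuous_on)
  have "weak_derivative w v"
    unfolding weak_derivative_def
  proof (intro allI impI)
    fix \<zeta> assume \<zeta>: "test_function \<zeta>"
    note \<zeta>' = test_function_differentiable[OF \<zeta>]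
    obtain N where N: "N > 0" "\<And>x. N \<le> \<bar>x\<bar> \<Longrightarrow> \<zeta> x = 0" "\<And>x. N \<le> \<bar>x\<bar> \<Longrightarrow> deriv \<zeta> x = 0"
      using test_function_bounded_support[OF \<zeta>] by metis
    have "((\<lambda>x. w x * \<zeta> x) has_real_derivative w x * deriv \<zeta> x + v x * \<zeta> x) (at x)" for x
      by (rule DERIV_cong[OF DERIV_mult[OF dw \<zeta>'(1)]]) (simp add: algebra_simps)
    then have FTC: "((\<lambda>x. w x * deriv \<zeta> x + v x * \<zeta> x) has_integral (w N * \<zeta> N - w (-N) * \<zeta> (-N))) {-N..N}"
      using N(1) by (intro fundamental_theorem_of_calculus)
        (auto simp: has_real_derivative_iff_has_vector_derivative intro: has_vector_derivative_at_within)
    have "((\<lambda>x. w x * deriv \<zeta> x) has_integral (LBINT x. w x * deriv \<zeta> x)) {-N..N}"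
      "((\<lambda>x. v x * \<zeta> x) has_integral (LBINT x. v x * \<zeta> x)) {-N..N}"
      using N(2,3) by (simp_all add: LBINT_has_integral continuous_on_mult cont_w cont_v \<zeta>')
    then have "((\<lambda>x. w x * deriv \<zeta> x + v x * \<zeta> x) has_integral
        ((LBINT x. w x * deriv \<zeta> x) + (LBINT x. v x * \<zeta> x))) {-N..N}"
      by (rule has_integral_add)
    from this FTC have "(LBINT x. w x * deriv \<zeta> x) + (LBINT x. v x * \<zeta> x) = w N * \<zeta> N - w (-N) * \<zeta> (-N)"
      by (rule has_integral_unique)
    then show "(LBINT x. w x * deriv \<zeta> x) = - (LBINT x. v x * \<zeta> x)"
      using N(2)[of N] N(2)[of "-N"] N(1) by simp
  qed
  moreover have "(LBINT x. v x * deriv \<zeta> x + k x * v x * \<zeta> x - f (w x) * \<zeta> x) \<ge> 0"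
    if \<zeta>: "test_function \<zeta>" and nonneg: "\<And>x. \<zeta> x \<ge> 0" for \<zeta>
  proof -
    note \<zeta>' = test_function_differentiable[OF \<zeta>]
    obtain N where N: "N > 0" "\<And>x. N \<le> \<bar>x\<bar> \<Longrightarrow> \<zeta> x = 0" "\<And>x. N \<le> \<bar>x\<bar> \<Longrightarrow> deriv \<zeta> x = 0"
      using test_function_bounded_support[OF \<zeta>] by metis
    let ?I = "LBINT x. v x * deriv \<zeta> x + k x * v x * \<zeta> x - f (w x) * \<zeta> x"
    have "((\<lambda>x. v x * deriv \<zeta> x + v2 x * \<zeta> x) has_integral (v N * \<zeta> N - v (-N) * \<zeta> (-N))) {-N..N}"
    \<comment> \<open>This version tolerates the finite set \<open>S\<close>. The possibly
      discontinuous \<open>v2\<close> occurs only under a gauge integral, so its measurability need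
      not be discussed.\<close>
    proof (rule fundamental_theorem_of_calculus_interior_strong[OF \<open>finite S\<close>])
      show "((\<lambda>x. v x * \<zeta> x) has_vector_derivative v x * deriv \<zeta> x + v2 x * \<zeta> x) (at x)"
        if "x \<in> {-N<..<N} - S" for x
        unfolding has_real_derivative_iff_has_vector_derivative[symmetric]
        using that by (intro DERIV_cong[OF DERIV_mult[OF dv \<zeta>'(1)]]) (auto simp: algebra_simps)
      show "continuous_on {-N..N} (\<lambda>x. v x * \<zeta> x)"
        by (intro continuous_intros \<zeta>' continuous_on_subset[OF cont_v]) auto
    qed (use N in auto)
    then have "((\<lambda>x. v x * deriv \<zeta> x + v2 x * \<zeta> x) has_integral 0) {-N..N}"
      using N by simp
    moreover have "((\<lambda>x. v x * deriv \<zeta> x + k x * v x * \<zeta> x - f (w x) * \<zeta> x) has_integral ?I) {-N..N}"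
      using N by (intro LBINT_has_integral continuous_intros cont_v cont_k cont_fw \<zeta>') auto
    ultimately show "?I \<ge> 0"
    proof (rule has_integral_le)
      fix x
      have "v2 x * \<zeta> x \<le> (k x * v x - f (w x)) * \<zeta> x"
        by (intro mult_right_mono super nonneg)
      then show "v x * deriv \<zeta> x + v2 x * \<zeta> x \<le> v x * deriv \<zeta> x + k x * v x * \<zeta> x - f (w x) * \<zeta> x"
        by (simp add: algebra_simps)
    qed
  qed
  ultimately show ?thesis
    unfolding stationary_supersolution_def
    using cont_w continuous_imp_L2_loc[OF cont_w] continuous_imp_L2_loc[OF cont_v] by blast
qed

subsection \<open>Construction of the barrier\<close>

text \<open>The point \<open>p\<close> belongs to the right piece, so a short right neighbourhood of
  any point stays within one piece. Hence neither values nor slopes have to match.\<close>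

lemma has_real_derivative_glue_right:
  assumes "x < p \<Longrightarrow> (g has_real_derivative a) (at x within {x..})"
    and "p \<le> x \<Longrightarrow> (h has_real_derivative b) (at x within {x..})"
  shows "((\<lambda>y. if y < p then g y else h y) has_real_derivative (if x < p then a else b)) (at x within {x..})"
    (is "(?w has_real_derivative _) _")
proof (cases "x < p")
  case True
  then show ?thesis
    using has_field_derivative_transform_within[OF assms(1)[OF True], where d = "p - x" and g = ?w]
    by (simp add: dist_real_def)
next
  case False
  then have "p \<le> x" by simp
  with False show ?thesis
    using has_field_derivative_transform_within[OF assms(2)[OF \<open>p \<le> x\<close>], where d = 1 and g = ?w]
    by (simp add: dist_real_def)
qed

lemma has_real_derivative_glue_off:
  assumes "x < p \<Longrightarrow> (g has_real_derivative a) (at x)"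
    and "p < x \<Longrightarrow> (h has_real_derivative b) (at x)" and "x \<noteq> p"
  shows "((\<lambda>y. if y < p then g y else h y) has_real_derivative (if x < p then a else b)) (at x)"
    (is "(?w has_real_derivative _) _")
proof (cases "x < p")
  case True
  have "g y = ?w y" if "dist y x < p - x" for y
    using that by (auto simp: dist_real_def)
  then have "(?w has_real_derivative a) (at x)"
    using has_field_derivative_transform_within[OF assms(1)[OF True], where d = "p - x" and g = ?w] True
    by simp
  then show ?thesis using True by simp
next
  case False
  then have "p < x" using assms(3) by simp
  have "h y = ?w y" if "dist y x < x - p" for y
    using that by (auto simp: dist_real_def)
  then have "(?w has_real_derivative b) (at x)"
    using has_field_derivative_transform_within[OF assms(2)[OF \<open>p < x\<close>], where d = "x - p" and g = ?w] \<open>p < x\<close>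
    by simp
  then show ?thesis using \<open>p < x\<close> by simp
qed

text \<open>At the junction the left and right derivatives are computed separately and combined over
  the union of the two half-lines.\<close>

lemma has_real_derivative_glue:
  assumes g: "x \<le> p \<Longrightarrow> (g has_real_derivative a) (at x)"
    and h: "p \<le> x \<Longrightarrow> (h has_real_derivative b) (at x)"
    and match: "g p = h p" "x = p \<Longrightarrow> a = b"
  shows "((\<lambda>y. if y < p then g y else h y) has_real_derivative (if x < p then a else b)) (at x)"
    (is "(?w has_real_derivative _) _")
proof (cases "x = p")
  case True
  have "(?w has_real_derivative a) (at x within {..x})"
  proof (rule has_field_derivative_transform_within[where d = 1])
    show "(g has_real_derivative a) (at x within {..x})"
      using g True by (blast intro: has_field_derivative_at_within)
    show "g y = ?w y" if "y \<in> {..x}" for y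
      using that True match(1) by (cases "y = p") auto
  qed auto
  moreover have "(?w has_real_derivative a) (at x within {x..})"
  proof (rule has_field_derivative_transform_within[where d = 1])
    show "(h has_real_derivative a) (at x within {x..})"
      using h True match(2) has_field_derivative_at_within by blast
    show "h y = ?w y" if "y \<in> {x..}" for y
      using that True by simp
  qed auto
  ultimately have "(?w has_real_derivative a) (at x within {..x} \<union> {x..})"
    by (simp only: has_field_derivative_iff Lim_within_Un)
  moreover have "{..x} \<union> {x..} = UNIV" by auto
  ultimately show ?thesis
    using True match(2) by simp
next
  case False
  with g h show ?thesis by (intro has_real_derivative_glue_off) auto
qed

lemma continuous_on_glue:
  fixes g h :: "real \<Rightarrow> real"
  assumes "continuous_on UNIV g" "continuous_on UNIV h" "g p = h p"
  shows "continuous_on UNIV (\<lambda>x. if x < p then g x else h x)"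
proof -
  have eq: "(\<lambda>x. if x < p then g x else h x) = (\<lambda>x. if x \<le> p then g x else h x)"
    using assms(3) by (auto simp: fun_eq_iff)
  show ?thesis
    unfolding eq using assms by (intro continuous_on_cases_le) (auto intro: continuous_on_subset)
qed

text \<open>The barrier is an exponential on the left, an exact solution of \<open>w'' = k w'\<close> on the support of
  the drift, where \<open>f(w) \<le> 0\<close>, and a parabola joining it to the constant \<open>1\<close> on the right. Choosing the value
  \<open>b / \<mu>\<close> at \<open>-x0\<close> and the width \<open>2 (1 - w(0)) / w'(0)\<close> of the parabola makes it \<open>C\<^sup>1\<close>.\<close>

lemma barrier_exists:
  fixes f k P G :: "real \<Rightarrow> real"
  assumes params: "0 < \<alpha>" "\<alpha> \<le> \<theta> / 2" "\<theta> < 1" "0 < \<mu>" "0 < M" "0 < x0"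
    and f_near_0: "\<And>s. 0 \<le> s \<Longrightarrow> s \<le> \<alpha> \<Longrightarrow> f s \<le> - \<mu>\<^sup>2 * s"
    and f_nonpos: "\<And>s. 0 \<le> s \<Longrightarrow> s \<le> \<theta> \<Longrightarrow> f s \<le> 0"
    and f_le: "\<And>s. 0 \<le> s \<Longrightarrow> s \<le> 1 \<Longrightarrow> f s \<le> M"
    and f_1: "f 1 = 0"
    and k_left: "\<And>x. x \<le> -x0 \<Longrightarrow> k x = 0" and k_right: "\<And>x. 0 \<le> x \<Longrightarrow> k x = 0"
    and dP: "\<And>x. (P has_real_derivative k x) (at x)" and P0: "P (-x0) = 0"
    and dG: "\<And>x. (G has_real_derivative exp (P x)) (at x)" and G0: "G (-x0) = 0"
    and b: "0 < b" "b / \<mu> \<le> \<alpha>" "b * G 0 \<le> \<theta> / 2" "2 * M \<le> (b * exp (P 0))\<^sup>2"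
  obtains w v v2 :: "real \<Rightarrow> real" and l :: real and S :: "real set" where
    "\<And>x. (w has_real_derivative v x) (at x)" "\<And>x. (v has_real_derivative v2 x) (at x within {x..})"
    "finite S" "\<And>x. x \<notin> S \<Longrightarrow> (v has_real_derivative v2 x) (at x)"
    "\<And>x. v2 x \<le> k x * v x - f (w x)" "continuous_on UNIV v"
    "\<And>x. 0 < w x" "\<And>x. w x \<le> 1" "\<And>x. l \<le> x \<Longrightarrow> w x = 1" "(w \<longlongrightarrow> 0) at_bot"
proof -
  define a where "a = b / \<mu>"
  define w0 where "w0 = a + b * G 0"
  define p where "p = b * exp (P 0)"
  define l where "l = 2 * (1 - w0) / p"
  define q where "q = (1 - w0) / l\<^sup>2"
  have "a > 0" "a \<le> \<alpha>" "a * \<mu> = b" using b params by (auto simp: a_def)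
  have G_mono: "G x \<le> G y" if "x \<le> y" for x y
    using dG that by (intro DERIV_nonneg_imp_nondecreasing[OF that]) (meson exp_ge_zero)
  have "0 \<le> b * G 0"
    using b(1) params G_mono[of "-x0" 0] G0 by simp
  \<comment> \<open>Half of \<open>\<theta>\<close> is spent on \<open>a \<le> \<alpha>\<close>, the
    other half on the increment \<open>b * G 0\<close> across the drift.\<close>
  then have w0: "0 < w0" "w0 \<le> \<theta>" "w0 < 1"
    using \<open>a > 0\<close> \<open>a \<le> \<alpha>\<close> b params
    by (auto simp: w0_def)
  have "p > 0" using b by (simp add: p_def)
  have "l > 0" using w0 \<open>p > 0\<close> by (simp add: l_def)
  have "q > 0" using w0 \<open>l > 0\<close> by (simp add: q_def)
  have ql: "q * l\<^sup>2 = 1 - w0" using \<open>l > 0\<close> by (simp add: q_def)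
  have "2 * q * l = p"
  proof -
    have "2 * q * l = 2 * (1 - w0) / l"
      using \<open>l > 0\<close> by (simp add: q_def power2_eq_square)
    also have "\<dots> = p" using w0 \<open>p > 0\<close> by (simp add: l_def)
    finally show ?thesis .
  qed
  \<comment> \<open>From \<open>p = 2 * q * l\<close> and \<open>q * l\<^sup>2 = 1 - w0\<close>
    follows \<open>p\<^sup>2 = 4 * q * (1 - w0)\<close>, so the assumed lower bound
    \<open>2 * M\<close> for \<open>p\<^sup>2\<close> becomes one for the curvature.\<close>
  have "M \<le> 2 * q"
  proof -
    have "2 * M * (1 - w0) \<le> 2 * M * 1"
      using w0 params by (intro mult_left_mono) auto
    also have "\<dots> \<le> p\<^sup>2" using b by (simp add: p_def)
    also have "p\<^sup>2 = 4 * q * (q * l\<^sup>2)"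
      by (simp add: \<open>2 * q * l = p\<close>[symmetric] power2_eq_square)
    also have "\<dots> = 4 * q * (1 - w0)" by (simp add: ql)
    finally show ?thesis using w0 by simp
  qed

  define w where "w = (\<lambda>x. if x < -x0 then a * exp (\<mu> * (x + x0)) else
     if x < 0 then a + b * G x else if x < l then 1 - q * (l - x)\<^sup>2 else 1)"
  define v where "v = (\<lambda>x. if x < -x0 then b * exp (\<mu> * (x + x0)) else
     if x < 0 then b * exp (P x) else if x < l then 2 * q * (l - x) else 0)"
  define v2 where "v2 = (\<lambda>x. if x < -x0 then b * \<mu> * exp (\<mu> * (x + x0)) else
     if x < 0 then b * (k x * exp (P x)) else if x < l then - (2 * q) else 0)"

  have 1: "((\<lambda>x. a * exp (\<mu> * (x + x0))) has_real_derivative b * exp (\<mu> * (x + x0))) (at x)" for x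
    using \<open>a * \<mu> = b\<close> by (auto intro!: derivative_eq_intros)
  have 2: "((\<lambda>x. a + b * G x) has_real_derivative b * exp (P x)) (at x)" for x
    by (auto intro!: derivative_eq_intros dG)
  have 3: "((\<lambda>x. 1 - q * (l - x)\<^sup>2) has_real_derivative 2 * q * (l - x)) (at x)" for x
    by (auto intro!: derivative_eq_intros simp: algebra_simps)
  have 4: "((\<lambda>x. b * exp (\<mu> * (x + x0))) has_real_derivative b * \<mu> * exp (\<mu> * (x + x0))) (at x)" for x
    by (auto intro!: derivative_eq_intros)
  have 5: "((\<lambda>x. b * exp (P x)) has_real_derivative b * (k x * exp (P x))) (at x)" for x
    by (auto intro!: derivative_eq_intros dP)
  have 6: "((\<lambda>x. 2 * q * (l - x)) has_real_derivative - (2 * q)) (at x)" for x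
    by (auto intro!: derivative_eq_intros)
  have dw: "(w has_real_derivative v x) (at x)" for x
    unfolding w_def v_def
    by (intro has_real_derivative_glue 1 2 3 DERIV_const)
      (use params \<open>l > 0\<close> ql \<open>2 * q * l = p\<close> in \<open>auto simp: P0 G0 w0_def p_def\<close>)
  have dv: "(v has_real_derivative v2 x) (at x within {x..})" for x
    unfolding v_def v2_def
    by (intro has_real_derivative_glue_right 4 5 6 DERIV_const has_field_derivative_at_within)
  have dv': "(v has_real_derivative v2 x) (at x)" if "x \<notin> {-x0, 0, l}" for x
    unfolding v_def v2_def
    by (intro has_real_derivative_glue_off 4 5 6 DERIV_const) (use that in auto)
  have w_left: "a * exp (\<mu> * (x + x0)) \<le> a" if "x < -x0" for x
  proof -
    have "\<mu> * (x + x0) \<le> 0" using that params by (intro mult_nonneg_nonpos) auto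
    then show ?thesis using \<open>a > 0\<close> by simp
  qed
  have w_mid: "a \<le> a + b * G x" "a + b * G x \<le> w0" if "-x0 \<le> x" "x < 0" for x
    using that G_mono[of "-x0" x] G_mono[of x 0] G0 b by (auto simp: w0_def)
  have w_right: "w0 \<le> 1 - q * (l - x)\<^sup>2" "1 - q * (l - x)\<^sup>2 \<le> 1" if "0 \<le> x" "x < l" for x
  proof -
    have "q * (l - x)\<^sup>2 \<le> q * l\<^sup>2"
      using that \<open>q > 0\<close> by (intro mult_left_mono power_mono) auto
    then show "w0 \<le> 1 - q * (l - x)\<^sup>2" using ql by simp
    show "1 - q * (l - x)\<^sup>2 \<le> 1" using \<open>q > 0\<close> by simp
  qed
  show thesis
  proof (rule that[of w v v2 "{-x0, 0, l}" l])
    show "continuous_on UNIV v"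
      unfolding v_def
      by (intro continuous_on_glue has_real_derivative_imp_continuous_on[OF 4]
          has_real_derivative_imp_continuous_on[OF 5] has_real_derivative_imp_continuous_on[OF 6] continuous_on_const)
        (use params \<open>l > 0\<close> \<open>2 * q * l = p\<close> in \<open>auto simp: P0 p_def\<close>)
    show "0 < w x" for x
      using \<open>a > 0\<close> w0 w_mid[of x] w_right[of x] by (auto simp: w_def)
    show "w x \<le> 1" for x
      using \<open>a \<le> \<alpha>\<close> params w0 w_left[of x] w_mid[of x] w_right[of x] by (auto simp: w_def)
    show "w x = 1" if "l \<le> x" for x
      using that \<open>l > 0\<close> params by (simp add: w_def)
    show "v2 x \<le> k x * v x - f (w x)" for x
    proof -
      \<comment> \<open>On the four pieces the inequality reduces to
        \<open>\<mu>\<^sup>2 * w x \<le> - f (w x)\<close>, to \<open>f (w x) \<le> 0\<close>, to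
        \<open>f (w x) \<le> 2 * q\<close>, and to an equality.\<close>
      consider "x < -x0" | "-x0 \<le> x" "x < 0" | "0 \<le> x" "x < l" | "l \<le> x" by linarith
      then show ?thesis
      proof cases
        case 1
        then have "f (w x) \<le> - \<mu>\<^sup>2 * w x"
          using \<open>a > 0\<close> order_trans[OF w_left \<open>a \<le> \<alpha>\<close>] by (intro f_near_0) (auto simp: w_def)
        moreover have "v2 x = \<mu>\<^sup>2 * w x"
          using 1 \<open>a * \<mu> = b\<close> by (auto simp: v2_def w_def power2_eq_square)
        ultimately show ?thesis using 1 k_left[of x] by simp
      next
        case 2
        then have "f (w x) \<le> 0"
          using w_mid[of x] \<open>a > 0\<close> w0 by (intro f_nonpos) (auto simp: w_def)
        then show ?thesis using 2 by (simp add: v_def v2_def)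
      next
        case 3
        then have "f (w x) \<le> M"
          using w_right[of x] w0 params by (intro f_le) (auto simp: w_def)
        then show ?thesis using 3 params k_right[of x] \<open>M \<le> 2 * q\<close> by (simp add: v2_def)
      next
        case 4
        then show ?thesis using \<open>l > 0\<close> params f_1 by (simp add: v_def v2_def w_def)
      qed
    qed
    have "((\<lambda>x. a * exp (\<mu> * (x + x0))) \<longlongrightarrow> a * 0) at_bot"
    proof (intro tendsto_mult tendsto_const filterlim_compose[OF exp_at_bot])
      show "filterlim (\<lambda>x. \<mu> * (x + x0)) at_bot at_bot"
        unfolding filterlim_at_bot
      proof
        fix Z
        show "eventually (\<lambda>x. \<mu> * (x + x0) \<le> Z) at_bot"
          using eventually_le_at_bot[of "Z / \<mu> - x0"]
          by eventually_elim (use params in \<open>simp add: field_simps\<close>)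
      qed
    qed
    moreover have "eventually (\<lambda>x. a * exp (\<mu> * (x + x0)) = w x) at_bot"
      using eventually_gt_at_bot[of "-x0"] by eventually_elim (simp add: w_def)
    ultimately show "(w \<longlongrightarrow> 0) at_bot"
      by (auto intro: Lim_transform_eventually)
  qed (use dw dv dv' in auto)
qed

text \<open>Continuity of the derivative keeps it below half of its negative value at 0 on a short
  interval. The mean value theorem then yields both the strict decrease and the linear
  bound.\<close>

lemma bistable_constants:
  assumes "bistable f"
  obtains \<alpha> \<theta> \<mu> M where "0 < \<alpha>" "\<alpha> \<le> \<theta> / 2" "\<theta> < 1" "0 < \<mu>" "0 < M"
    "\<And>s s'. 0 \<le> s \<Longrightarrow> s < s' \<Longrightarrow> s' \<le> \<alpha> \<Longrightarrow> f s' < f s"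
    "\<And>s. 0 \<le> s \<Longrightarrow> s \<le> \<alpha> \<Longrightarrow> f s \<le> - \<mu>\<^sup>2 * s"
    "\<And>s. 0 \<le> s \<Longrightarrow> s \<le> \<theta> \<Longrightarrow> f s \<le> 0"
    "\<And>s. 0 \<le> s \<Longrightarrow> s \<le> 1 \<Longrightarrow> f s \<le> M"
    "f 1 = 0" "continuous_on {0..1} f"
proof -
  obtain f1 f2 where
    df: "\<And>s. s \<in> {0..1} \<Longrightarrow> (f has_real_derivative f1 s) (at s within {0..1})" and
    df1: "\<And>s. s \<in> {0..1} \<Longrightarrow> (f1 has_real_derivative f2 s) (at s within {0..1})" and
    f1: "f1 0 < 0"
    using assms unfolding bistable_def by blast
  obtain \<theta>0 where \<theta>0: "0 < \<theta>0" "\<theta>0 < 1" "\<And>s. s \<in> {0<..<\<theta>0} \<Longrightarrow> f s < 0"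
    using assms unfolding bistable_def by auto
  have f01: "f 0 = 0" "f 1 = 0"
    using assms unfolding bistable_def by auto
  define \<theta> where "\<theta> = \<theta>0 / 2"
  define \<mu> where "\<mu> = sqrt (- f1 0 / 2)"
  have \<mu>: "\<mu> > 0" "- \<mu>\<^sup>2 = f1 0 / 2" using f1 by (auto simp: \<mu>_def)
  have cont: "continuous_on {0..1} f"
    using df by (rule DERIV_continuous_on)
  have "continuous_on {0..1} f1"
    using df1 by (rule DERIV_continuous_on)
  moreover have "- f1 0 / 2 > 0" using f1 by simp
  ultimately obtain d where "d > 0" "\<forall>s\<in>{0..1}. dist s 0 < d \<longrightarrow> dist (f1 s) (f1 0) < - f1 0 / 2"
    unfolding continuous_on_iff by (meson atLeastAtMost_iff order_refl zero_le_one)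
  then have d: "d > 0" "\<And>s. s \<in> {0..1} \<Longrightarrow> \<bar>s\<bar> < d \<Longrightarrow> \<bar>f1 s - f1 0\<bar> < - f1 0 / 2"
    by (simp_all add: dist_real_def)
  \<comment> \<open>The first entry keeps the interval where the slope is controlled; the second
    reserves \<open>\<theta> / 2\<close> for the rise of the barrier across the drift.\<close>
  define \<alpha> where "\<alpha> = min (d / 2) (\<theta> / 2)"
  have \<alpha>: "0 < \<alpha>" "\<alpha> < d" "\<alpha> \<le> \<theta> / 2" "\<alpha> < 1"
    using d \<theta>0 by (auto simp: \<alpha>_def \<theta>_def)
  have slope: "f s' - f s \<le> - \<mu>\<^sup>2 * (s' - s)" if "0 \<le> s" "s < s'" "s' \<le> \<alpha>" for s s'
  proof -
    have "\<exists>\<xi>\<in>{s<..<s'}. f s' - f s = f1 \<xi> * (s' - s)"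
    proof (rule mvt_simple[OF \<open>s < s'\<close>])
      show "(f has_derivative (*) (f1 x)) (at x within {s..s'})" if "s \<le> x" "x \<le> s'" for x
        using df[of x] that \<open>0 \<le> s\<close> \<open>s' \<le> \<alpha>\<close> \<alpha>
        by (auto simp: has_field_derivative_def intro: has_derivative_subset)
    qed
    then obtain \<xi> where \<xi>: "\<xi> \<in> {s<..<s'}" "f s' - f s = f1 \<xi> * (s' - s)" by blast
    then have "f1 \<xi> \<le> - \<mu>\<^sup>2"
      using d(2)[of \<xi>] that \<alpha> \<mu>(2) by (auto simp: abs_if split: if_splits)
    then have "f1 \<xi> * (s' - s) \<le> - \<mu>\<^sup>2 * (s' - s)"
      using that by (intro mult_right_mono) auto
    then show ?thesis by (simp only: \<xi>)
  qed
  have "compact {0..1::real}" "{0..1::real} \<noteq> {}" by auto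
  then obtain z where z: "\<And>s. s \<in> {0..1} \<Longrightarrow> f s \<le> f z"
    using continuous_attains_sup[of "{0..1}" f] cont by blast
  show thesis
  proof (rule that[of \<alpha> \<theta> \<mu> "\<bar>f z\<bar> + 1"])
    show "f s' < f s" if "0 \<le> s" "s < s'" "s' \<le> \<alpha>" for s s'
    proof -
      have "- \<mu>\<^sup>2 * (s' - s) < 0" using \<mu>(1) that by simp
      then show ?thesis using slope[OF that] by linarith
    qed
    show "f s \<le> - \<mu>\<^sup>2 * s" if "0 \<le> s" "s \<le> \<alpha>" for s
      using slope[of 0 s] that f01 by (cases "s = 0") auto
    show "f s \<le> 0" if "0 \<le> s" "s \<le> \<theta>" for s
      using that \<theta>0(3)[of s] f01 \<theta>0(1) by (cases "s = 0") (auto simp: \<theta>_def)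
    show "f s \<le> \<bar>f z\<bar> + 1" if "0 \<le> s" "s \<le> 1" for s
      using z[of s] that by auto
  qed (use \<alpha> \<mu> \<theta>0 f01 cont in \<open>auto simp: \<theta>_def\<close>)
qed

subsection \<open>Blocking\<close>

lemma continuous_antiderivative:
  fixes g :: "real \<Rightarrow> real"
  assumes "continuous_on UNIV g"
  obtains F where "\<And>x. (F has_real_derivative g x) (at x)" "F x0 = 0"
proof -
  obtain F where "\<And>x. (F has_real_derivative g x) (at x)"
    using einterval_antiderivative[of "-\<infinity>" "\<infinity>" g] assms
    by (auto simp: continuous_on_eq_continuous_at has_real_derivative_iff_has_vector_derivative)
  then have "((\<lambda>x. F x - F x0) has_real_derivative g x) (at x)" for x
    by (auto intro!: derivative_eq_intros)
  then show thesis by (rule that) simp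
qed

lemma set_LBINT_FTC:
  fixes g F :: "real \<Rightarrow> real"
  assumes "a \<le> b" "continuous_on UNIV g" "\<And>x. (F has_real_derivative g x) (at x)"
  shows "(LBINT x:{a..b}. g x) = F b - F a"
  unfolding set_lebesgue_integral_def
  using assms by (intro integral_FTC_atLeastAtMost)
    (auto intro: continuous_on_subset has_field_derivative_at_within
      simp: has_real_derivative_iff_has_vector_derivative[symmetric])

theorem theorem1p2:
  fixes f :: "real \<Rightarrow> real"
  assumes "bistable f" and "admissible_extension f"
  shows "\<exists>C>0. \<forall>\<phi> c x0 k u.
    traveling_wave f \<phi> c \<longrightarrow>
    x0 > 0 \<longrightarrow> test_function k \<longrightarrow> support k \<subseteq> {-x0..0} \<longrightarrow>
    C > exp (- (LBINT s. k s)) *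
        (2 + max 14 (sqrt (LBINT t:{-x0..0}. exp (LBINT s:{-x0..t}. k s))))\<^sup>2 \<longrightarrow>
    entire_solution f k \<phi> c u \<longrightarrow>
    blocked_left f k u"
proof (rule bistable_constants[OF assms(1)])
  fix \<alpha> \<theta> \<mu> M :: real
  assume params: "0 < \<alpha>" "\<alpha> \<le> \<theta> / 2" "\<theta> < 1" "0 < \<mu>" "0 < M"
    and f_decreasing: "\<And>s s'. 0 \<le> s \<Longrightarrow> s < s' \<Longrightarrow> s' \<le> \<alpha> \<Longrightarrow> f s' < f s"
    and f_near_0: "\<And>s. 0 \<le> s \<Longrightarrow> s \<le> \<alpha> \<Longrightarrow> f s \<le> - \<mu>\<^sup>2 * s"
    and f_nonpos: "\<And>s. 0 \<le> s \<Longrightarrow> s \<le> \<theta> \<Longrightarrow> f s \<le> 0"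
    and f_le: "\<And>s. 0 \<le> s \<Longrightarrow> s \<le> 1 \<Longrightarrow> f s \<le> M"
    and f_1: "f 1 = 0" and cont_f: "continuous_on {0..1} f"
  \<comment> \<open>The barrier needs a slope \<open>b\<close> at \<open>-x0\<close> with
    \<open>b \<le> \<alpha> * \<mu>\<close>, \<open>b * G 0 \<le> \<theta> / 2\<close> and
    \<open>sqrt (2 * M) \<le> b * exp (P 0)\<close>. The largest \<open>b\<close> allowed by the
    first two satisfies \<open>b * max 1 (G 0) \<ge> m\<close>, so the third holds if
    \<open>exp (- P 0) * max 1 (G 0) < m / sqrt (2 * M)\<close>.\<close>
  define m where "m = min (\<alpha> * \<mu>) (\<theta> / 2)"
  define C where "C = m / sqrt (2 * M)"
  have "m > 0" using params by (simp add: m_def)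
  then have "C > 0" using params by (simp add: C_def)
  moreover have "blocked_left f k u"
    if wave: "traveling_wave f \<phi> c" and "x0 > 0" and k: "test_function k" and supp: "support k \<subseteq> {-x0..0}"
      and C: "C > exp (- (LBINT s. k s)) *
        (2 + max 14 (sqrt (LBINT t:{-x0..0}. exp (LBINT s:{-x0..t}. k s))))\<^sup>2"
      and u: "entire_solution f k \<phi> c u"
    for \<phi> c x0 k u
  proof -
    have cont_k: "continuous_on A k" for A
      using k by (rule test_function_differentiable)
    have k_out: "k x = 0" if "x < -x0 \<or> 0 < x" for x
      using that supp by (intro not_in_supportD) auto
    \<comment> \<open>The zero set is closed, so the drift also vanishes at the end points
      \<open>-x0\<close> and 0, where the pieces of the barrier meet.\<close>
    have "closed {x. k x = 0}"
      by (intro closed_Collect_eq cont_k continuous_on_const)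
    then have "closure {..<-x0} \<subseteq> {x. k x = 0}" "closure {0<..} \<subseteq> {x. k x = 0}"
      using k_out by (intro closure_minimal; auto)+
    then have k_left: "\<And>x. x \<le> -x0 \<Longrightarrow> k x = 0" and k_right: "\<And>x. 0 \<le> x \<Longrightarrow> k x = 0"
      by auto
    obtain P where P: "\<And>x. (P has_real_derivative k x) (at x)" "P (-x0) = 0"
      using continuous_antiderivative[OF cont_k] by metis
    have cont_E: "continuous_on UNIV (\<lambda>x. exp (P x))"
      by (intro continuous_intros has_real_derivative_imp_continuous_on[OF P(1)])
    obtain G where G: "\<And>x. (G has_real_derivative exp (P x)) (at x)" "G (-x0) = 0"
      using continuous_antiderivative[OF cont_E] by metis
    have "G (-x0) < G 0"
    proof (rule DERIV_pos_imp_increasing[where f = G])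
      show "\<exists>D. (G has_real_derivative D) (at x) \<and> D > 0" for x
        using G(1)[of x] exp_gt_zero by blast
    qed (use \<open>x0 > 0\<close> in simp)
    then have "G 0 > 0" using G by simp
    have K: "(LBINT s. k s) = P 0"
    proof -
      have "(LBINT s. k s) = (LBINT s:{-x0..0}. k s)"
        using k_out by (intro LBINT_eq_set_LBINT) auto
      then show ?thesis
        using set_LBINT_FTC[OF _ cont_k P(1), of "-x0" 0] \<open>x0 > 0\<close> P(2) by simp
    qed
    have "(LBINT t:{-x0..0}. exp (LBINT s:{-x0..t}. k s)) = (LBINT t:{-x0..0}. exp (P t))"
      using set_LBINT_FTC[OF _ cont_k P(1)] P(2) by (intro set_lebesgue_integral_cong) auto
    also have "\<dots> = G 0"
      using set_LBINT_FTC[OF _ cont_E G(1), of "-x0" 0] \<open>x0 > 0\<close> G(2) by simp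
    finally have C': "C > exp (- P 0) * (2 + max 14 (sqrt (G 0)))\<^sup>2"
      using C K by simp
    \<comment> \<open>The bracket is at least 1 and at least \<open>sqrt (G 0)\<close>, so its
      square dominates both 1 and \<open>G 0\<close>.\<close>
    have "max 1 (G 0) \<le> (2 + max 14 (sqrt (G 0)))\<^sup>2"
    proof -
      have "1\<^sup>2 \<le> (2 + max 14 (sqrt (G 0)))\<^sup>2" "(sqrt (G 0))\<^sup>2 \<le> (2 + max 14 (sqrt (G 0)))\<^sup>2"
        using \<open>G 0 > 0\<close> by (intro power_mono; simp)+
      then show ?thesis using \<open>G 0 > 0\<close> by simp
    qed
    then have "exp (- P 0) * max 1 (G 0) < C"
      using C' by (meson exp_ge_zero mult_left_mono le_less_trans)
    then have strong: "sqrt (2 * M) * max 1 (G 0) < m * exp (P 0)"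
      using params by (simp add: C_def exp_minus field_simps)
    define b where "b = min (\<alpha> * \<mu>) (\<theta> / 2 / G 0)"
    have "b > 0" using params \<open>G 0 > 0\<close> by (simp add: b_def)
    have "b \<le> \<alpha> * \<mu>" "b \<le> \<theta> / 2 / G 0" by (simp_all add: b_def)
    then have b: "b / \<mu> \<le> \<alpha>" "b * G 0 \<le> \<theta> / 2"
      using params \<open>G 0 > 0\<close> by (simp_all add: field_simps)
    have "m \<le> b * max 1 (G 0)"
    proof (cases "b = \<alpha> * \<mu>")
      case True
      have "m \<le> b * 1" using True by (simp add: m_def)
      also have "\<dots> \<le> b * max 1 (G 0)" using \<open>b > 0\<close> by (intro mult_left_mono) auto
      finally show ?thesis .
    next
      case False
      then have "b = \<theta> / 2 / G 0" by (auto simp: b_def min_def)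
      then have "m \<le> b * G 0" using \<open>G 0 > 0\<close> by (simp add: m_def)
      also have "\<dots> \<le> b * max 1 (G 0)" using \<open>b > 0\<close> by (intro mult_left_mono) auto
      finally show ?thesis .
    qed
    then have "m * exp (P 0) \<le> b * max 1 (G 0) * exp (P 0)" by (intro mult_right_mono) auto
    also have "\<dots> = b * exp (P 0) * max 1 (G 0)" by simp
    finally have "sqrt (2 * M) * max 1 (G 0) \<le> b * exp (P 0) * max 1 (G 0)"
      using strong by linarith
    then have "sqrt (2 * M) \<le> b * exp (P 0)"
      by (rule mult_right_le_imp_le) auto
    then have steep: "2 * M \<le> (b * exp (P 0))\<^sup>2"
      by (rule sqrt_le_D)
    show ?thesis
    proof (rule barrier_exists[OF params \<open>x0 > 0\<close> f_near_0 f_nonpos f_le f_1 k_left k_right P G \<open>b > 0\<close> b steep])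
      fix w v v2 :: "real \<Rightarrow> real" and l :: real and S :: "real set"
      assume w: "\<And>x. (w has_real_derivative v x) (at x)"
        "\<And>x. (v has_real_derivative v2 x) (at x within {x..})"
        "finite S" "\<And>x. x \<notin> S \<Longrightarrow> (v has_real_derivative v2 x) (at x)"
        "\<And>x. v2 x \<le> k x * v x - f (w x)" "continuous_on UNIV v"
        "\<And>x. 0 < w x" "\<And>x. w x \<le> 1" "\<And>x. l \<le> x \<Longrightarrow> w x = 1" "(w \<longlongrightarrow> 0) at_bot"
      have "continuous_on UNIV (\<lambda>x. f (w x))"
        using less_imp_le[OF w(7)] w(8)
        by (intro continuous_on_compose2[OF cont_f has_real_derivative_imp_continuous_on[OF w(1)]]) auto
      then have "stationary_supersolution f k w"
        using w by (intro stationary_supersolutionI[OF w(1,6,3,4,5) cont_k])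
      moreover have "u t x \<le> w x" for t x
      proof -
        obtain ut ux uxx where
          "\<And>t x. ((\<lambda>s. u s x) has_real_derivative ut t x) (at t)"
          "\<And>t x. ((\<lambda>y. u t y) has_real_derivative ux t x) (at x)"
          "\<And>t x. ((\<lambda>y. ux t y) has_real_derivative uxx t x) (at x)"
          "continuous_on UNIV (\<lambda>(t, x). ux t x)"
          "\<And>t x. ut t x - uxx t x + k x * ux t x = f (u t x)"
          "\<And>t x. ut t x > 0"
          using u unfolding entire_solution_def by blast
        moreover have "\<And>t x. 0 < u t x" "\<And>t x. u t x < 1"
          and lim: "uniform_limit UNIV (\<lambda>t x. u t x - \<phi> (x + c * t)) (\<lambda>x. 0) at_bot"
          using u unfolding entire_solution_def by auto
        \<comment> \<open>The upper bound \<open>M\<close> serves as \<open>F\<close>, and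
          \<open>\<alpha>\<close> as the threshold \<open>\<delta>\<close> below which
          \<open>f\<close> decreases.\<close>
        ultimately interpret solution_and_supersolution f k u ut ux uxx x0 M w v v2 \<alpha> l
          using params by unfold_locales
            (auto intro: f_le k_left w f_decreasing less_imp_le)
        show ?thesis
          using wave lim by (intro comparison comparison_initial[of c \<phi>]) (auto simp: traveling_wave_def)
      qed
      ultimately show ?thesis
        unfolding blocked_left_def using w(10) by blast
    qed
  qed
  ultimately show ?thesis by blast
qed

end
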